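(* For every $g\in\mathbb{N}$ (positive integer), the set $S(g)=\{m\in\mathbb{N}\mid \exists\, A\in \mathrm{Sp}(2g,\mathbb{Z}),\ A\neq 1,\ o(A)=m\}$ is a bounded subset of $\mathbb{R}$.
   Context: $\mathrm{Sp}(2g,\mathbb{Z})$ denotes the group of all $2g\times 2g$ integer matrices $A$ satisfying $A^{\top}JA=J$, where $J=\begin{pmatrix}0_g & I_g\\ -I_g & 0_g\end{pmatrix}$. The identity matrix is written $1$, and $o(A)$ denotes the order of $A$ in this group; $o(A)=m$ with $m\in\mathbb{N}$ means that $A$ has finite order exactly $m$. $\mathbb{N}$ is the set of positive integers. *)

theory Defs
  imports
    "HOL-Analysis.Elementary_Metric_Spaces"
    "HOL-Algebra.Multiplicative_Group"
    "Jordan_Normal_Form.Determinant"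
begin

definition sympl_J :: "nat \<Rightarrow> int mat" where
  "sympl_J g = four_block_mat (0\<^sub>m g g) (1\<^sub>m g) (- 1\<^sub>m g) (0\<^sub>m g g)"

text \<open>The argument \<open>g\<close> is half the matrix size: \<open>Sp g\<close> is the group written Sp(2g, Z).\<close>

definition Sp :: "nat \<Rightarrow> int mat monoid" where
  "Sp g = \<lparr>
     carrier = {A \<in> carrier_mat (2 * g) (2 * g). transpose_mat A * sympl_J g * A = sympl_J g},
     monoid.mult = (*),
     one = 1\<^sub>m (2 * g)\<rparr>"

text \<open>The library's \<open>ord\<close> is \<open>0\<close> on elements of infinite order, so \<open>0 < m\<close> is what
  restricts to finite order.  It is also meaningful only in a group; see \<open>group_Sp\<close> below.\<close>

definition orders :: "nat \<Rightarrow> nat set" where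
  "orders g = {m. 0 < m \<and> (\<exists>A \<in> carrier (Sp g). A \<noteq> \<one>\<^bsub>Sp g\<^esub> \<and> group.ord (Sp g) A = m)}"

lemma sympl_J_carrier [simp]: "sympl_J g \<in> carrier_mat (2 * g) (2 * g)"
  unfolding sympl_J_def mult_2 by (rule four_block_carrier_mat) auto

lemma sympl_J_sq: "sympl_J g * sympl_J g = - 1\<^sub>m (2 * g)"
proof -
  have "sympl_J g * sympl_J g = four_block_mat (- 1\<^sub>m g) (0\<^sub>m g g) (0\<^sub>m g g) (- 1\<^sub>m g)"
    unfolding sympl_J_def
    by (subst mult_four_block_mat[of _ g g _ g _ g _ _ g _ g]) auto
  also have "\<dots> = - 1\<^sub>m (2 * g)"
    by (rule eq_matI) auto
  finally show ?thesis .
qed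

lemma sympl_J_transpose: "transpose_mat (sympl_J g) = - sympl_J g"
  unfolding sympl_J_def
  by (subst transpose_four_block_mat[of _ g g _ g _ g]) (auto intro!: eq_matI)

lemma int_mat_mult_left_right_inverse:
  fixes A B :: "int mat"
  assumes A: "A \<in> carrier_mat n n" and B: "B \<in> carrier_mat n n" and BA: "B * A = 1\<^sub>m n"
  shows "A * B = 1\<^sub>m n"
proof -
  let ?h = "map_mat rat_of_int"
  have "?h B * ?h A = 1\<^sub>m n"
    using of_int_hom.mat_hom_mult[OF B A] of_int_hom.mat_hom_one BA by metis
  hence "?h A * ?h B = 1\<^sub>m n"
    using mat_mult_left_right_inverse[of "?h B" n "?h A"] A B by auto
  hence "?h (A * B) = ?h (1\<^sub>m n)"
    using of_int_hom.mat_hom_mult[OF A B] of_int_hom.mat_hom_one by metis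
  thus ?thesis by (rule of_int_hom.mat_hom_inj)
qed

lemma group_Sp: "group (Sp g)"
proof (rule groupI)
  let ?n = "2 * g" and ?J = "sympl_J g"
  note J = sympl_J_carrier[of g]
  note assoc = assoc_mult_mat[of _ ?n ?n _ ?n _ ?n] and closed = mult_carrier_mat[of _ ?n ?n _ ?n]
  have dJ [simp]: "dim_row ?J = ?n" "dim_col ?J = ?n" using carrier_matD[OF J] by blast+
  fix x assume "x \<in> carrier (Sp g)"
  hence x: "x \<in> carrier_mat ?n ?n" and xJ: "transpose_mat x * ?J * x = ?J"
    by (auto simp: Sp_def)
  have xT: "transpose_mat x \<in> carrier_mat ?n ?n" using x by simp
  have dx [simp]: "dim_row x = ?n" "dim_col x = ?n" using x by auto
  {
    fix y assume "y \<in> carrier (Sp g)"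
    hence y: "y \<in> carrier_mat ?n ?n" and yJ: "transpose_mat y * ?J * y = ?J"
      by (auto simp: Sp_def)
    have yT: "transpose_mat y \<in> carrier_mat ?n ?n" using y by simp
    have dy [simp]: "dim_row y = ?n" "dim_col y = ?n" using y by auto
    have "transpose_mat (x * y) * ?J * (x * y) =
        transpose_mat y * (transpose_mat x * ?J * x) * y"
      using x y xT yT J by (simp only: transpose_mult[OF x y] assoc closed)
    also have "\<dots> = ?J" using xJ yJ by simp
    finally show "x \<otimes>\<^bsub>Sp g\<^esub> y \<in> carrier (Sp g)"
      using x y by (simp add: Sp_def)
  }
  define y where "y = - (?J * (transpose_mat x * ?J))"
  have y: "y \<in> carrier_mat ?n ?n" using x J by (auto simp: y_def)
  have yT: "transpose_mat y \<in> carrier_mat ?n ?n" using y by simp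
  have yx: "y * x = 1\<^sub>m ?n"
  proof -
    have "y * x = - (?J * (transpose_mat x * ?J * x))"
      using x xT J by (simp add: y_def assoc closed del: assoc_mult_mat)
    thus ?thesis by (simp only: xJ sympl_J_sq) simp
  qed
  have xy: "x * y = 1\<^sub>m ?n"
    by (rule int_mat_mult_left_right_inverse[OF x y yx])
  have "transpose_mat y * ?J * y = transpose_mat y * (transpose_mat x * ?J * x) * y"
    by (simp only: xJ)
  also have "\<dots> = (transpose_mat y * transpose_mat x) * ?J * (x * y)"
    using x y xT yT J by (simp only: assoc closed)
  also have "\<dots> = ?J"
    by (simp only: transpose_mult[OF x y, symmetric] xy transpose_one
        left_mult_one_mat[OF J] right_mult_one_mat[OF J])
  finally show "\<exists>y\<in>carrier (Sp g). y \<otimes>\<^bsub>Sp g\<^esub> x = \<one>\<^bsub>Sp g\<^esub>"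
    using y yx by (auto simp: Sp_def)
qed (auto simp: Sp_def left_mult_one_mat[OF sympl_J_carrier] right_mult_one_mat[OF sympl_J_carrier])

end

theory Submission
  imports Defs
begin

text \<open>
  Minkowski's argument: reduction modulo 3 is injective on the powers of a matrix of finite order
  in GL(n, Z), so such an order is at most the number of n by n matrices over Z/3Z. Injectivity says
  that a matrix \<open>B\<close> of finite order congruent to 1 modulo 3 is 1. If \<open>B = 1 + 3^k C\<close> with \<open>k \<ge> 1\<close>
  and \<open>B ^ m = 1\<close> where \<open>m = 3\<close> or 3 does not divide \<open>m\<close>, the linear term of the binomial expansion
  forces 3 to divide \<open>C\<close>, and hence \<open>B - 1\<close> is divisible by every power of 3. The general exponent
  is reduced to these two cases by splitting off factors 3.
\<close>

section \<open>Powers of square matrices\<close>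

lemma one_mat_pow: "(1\<^sub>m n :: 'a :: semiring_1 mat) ^\<^sub>m k = 1\<^sub>m n"
  by (induction k) auto

lemma pow_mat_add:
  fixes A :: "'a :: semiring_1 mat"
  assumes A: "A \<in> carrier_mat n n"
  shows "A ^\<^sub>m (i + j) = A ^\<^sub>m i * A ^\<^sub>m j"
proof (induction j)
  case 0
  show ?case using A by simp
next
  case (Suc j)
  thus ?case
    using A assoc_mult_mat[OF pow_carrier_mat[OF A] pow_carrier_mat[OF A] A] by simp
qed

lemma pow_mat_mult:
  fixes A :: "'a :: semiring_1 mat"
  assumes A: "A \<in> carrier_mat n n"
  shows "A ^\<^sub>m (i * j) = (A ^\<^sub>m i) ^\<^sub>m j"
proof (induction j)
  case 0
  show ?case using A by simp
next
  case (Suc j)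
  thus ?case
    using pow_mat_add[OF A, of "i * j" i] by (simp add: add.commute)
qed

section \<open>Expansion of powers of \<open>1 + q C\<close>\<close>

lemma one_plus_smult_pow_mat:
  fixes C :: "int mat"
  assumes C: "C \<in> carrier_mat n n"
  shows "\<exists>E \<in> carrier_mat n n.
    (1\<^sub>m n + q \<cdot>\<^sub>m C) ^\<^sub>m m = 1\<^sub>m n + q \<cdot>\<^sub>m (int m \<cdot>\<^sub>m C + q \<cdot>\<^sub>m E)"
proof (induction m)
  case 0
  show ?case
    using C by (intro bexI[of _ "0\<^sub>m n n"]) (auto intro!: eq_matI)
next
  case (Suc m)
  then obtain E where E: "E \<in> carrier_mat n n"
    and pow: "(1\<^sub>m n + q \<cdot>\<^sub>m C) ^\<^sub>m m = 1\<^sub>m n + q \<cdot>\<^sub>m (int m \<cdot>\<^sub>m C + q \<cdot>\<^sub>m E)"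
    by blast
  \<comment> \<open>Multiplying \<open>1 + q ?X\<close> by \<open>1 + q C\<close> gives the terms
    \<open>q * q\<close> times \<open>E + ?X * C\<close>; the witness is this sum with
    \<open>?X * C\<close> expanded.\<close>
  let ?E = "E + int m \<cdot>\<^sub>m (C * C) + q \<cdot>\<^sub>m (E * C)"
  have CC: "C * C \<in> carrier_mat n n" and EC: "E * C \<in> carrier_mat n n"
    using C E by auto
  let ?X = "int m \<cdot>\<^sub>m C + q \<cdot>\<^sub>m E"
  have X: "?X \<in> carrier_mat n n" using C E by auto
  have XC: "?X * C = int m \<cdot>\<^sub>m (C * C) + q \<cdot>\<^sub>m (E * C)"
    using C E by (subst add_mult_distrib_mat[of _ n n _ _ n]) auto
  have "(1\<^sub>m n + q \<cdot>\<^sub>m C) ^\<^sub>m Suc m = (1\<^sub>m n + q \<cdot>\<^sub>m ?X) * (1\<^sub>m n + q \<cdot>\<^sub>m C)"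
    using pow by simp
  also have "\<dots> = (1\<^sub>m n + q \<cdot>\<^sub>m ?X) * 1\<^sub>m n + (1\<^sub>m n + q \<cdot>\<^sub>m ?X) * (q \<cdot>\<^sub>m C)"
    using C X by (intro mult_add_distrib_mat[of _ n n _ n]) auto
  also have "(1\<^sub>m n + q \<cdot>\<^sub>m ?X) * (q \<cdot>\<^sub>m C) = q \<cdot>\<^sub>m C + q \<cdot>\<^sub>m (q \<cdot>\<^sub>m (?X * C))"
    using C X by (subst add_mult_distrib_mat[of _ n n _ _ n])
      (auto simp: mult_smult_distrib[OF smult_carrier_mat[OF X] C] mult_smult_assoc_mat[OF X C])
  also have "(1\<^sub>m n + q \<cdot>\<^sub>m ?X) * 1\<^sub>m n = 1\<^sub>m n + q \<cdot>\<^sub>m ?X"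
    using X by (intro right_mult_one_mat[of _ n]) auto
  also have "1\<^sub>m n + q \<cdot>\<^sub>m ?X + (q \<cdot>\<^sub>m C + q \<cdot>\<^sub>m (q \<cdot>\<^sub>m (?X * C)))
      = 1\<^sub>m n + q \<cdot>\<^sub>m (int (Suc m) \<cdot>\<^sub>m C + q \<cdot>\<^sub>m ?E)"
    unfolding XC
    by (rule eq_matI; insert C E CC EC;
        simp add: carrier_matD[OF C] carrier_matD[OF E] carrier_matD[OF CC] carrier_matD[OF EC]
          algebra_simps del: index_mult_mat)
  finally show ?case
    using C E by (intro bexI[of _ ?E]) auto
qed

text \<open>For exponent 3 the linear term \<open>3 C\<close> is itself a multiple of 3, so an
  unspecified remainder \<open>q E\<close> would decide nothing when \<open>q = 3\<close>. The exact
  coefficients show the extra factors 3 and \<open>q\<close> in the higher terms.\<close>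

lemma one_plus_smult_cube_mat:
  fixes C :: "int mat"
  assumes C: "C \<in> carrier_mat n n"
  shows "(1\<^sub>m n + q \<cdot>\<^sub>m C) ^\<^sub>m 3
    = 1\<^sub>m n + q \<cdot>\<^sub>m (3 \<cdot>\<^sub>m C + (3 * q) \<cdot>\<^sub>m (C * C) + (q * q) \<cdot>\<^sub>m (C * C * C))"
proof -
  let ?B = "1\<^sub>m n + q \<cdot>\<^sub>m C"
  have CC: "C * C \<in> carrier_mat n n" and CCC: "C * C * C \<in> carrier_mat n n"
    using C by auto
  note dims = carrier_matD[OF C] carrier_matD[OF CC] carrier_matD[OF CCC]
  \<comment> \<open>Pascal's rule from the square to the cube, with \<open>X\<close>,
    \<open>Y\<close>, \<open>Z\<close> for the powers of \<open>C\<close>, so that the identity is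
    linear in their entries.\<close>
  have lin: "1\<^sub>m n + q \<cdot>\<^sub>m (2 \<cdot>\<^sub>m X + q \<cdot>\<^sub>m Y) + q \<cdot>\<^sub>m (X + q \<cdot>\<^sub>m (2 \<cdot>\<^sub>m Y + q \<cdot>\<^sub>m Z))
      = 1\<^sub>m n + q \<cdot>\<^sub>m (3 \<cdot>\<^sub>m X + (3 * q) \<cdot>\<^sub>m Y + (q * q) \<cdot>\<^sub>m Z)"
    if "X \<in> carrier_mat n n" "Y \<in> carrier_mat n n" "Z \<in> carrier_mat n n" for X Y Z
    using that by (intro eq_matI) (auto simp: algebra_simps)
  have step: "X * ?B = X + q \<cdot>\<^sub>m (X * C)" if X: "X \<in> carrier_mat n n" for X
    using C X by (subst mult_add_distrib_mat[of _ n n _ n]) (auto simp: mult_smult_distrib)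
  have sq: "?B * ?B = 1\<^sub>m n + q \<cdot>\<^sub>m (2 \<cdot>\<^sub>m C + q \<cdot>\<^sub>m (C * C))"
  proof -
    have BC: "?B * C = C + q \<cdot>\<^sub>m (C * C)"
      using C by (subst add_mult_distrib_mat[of _ n n _ _ n]) auto
    show ?thesis
      unfolding step[OF add_carrier_mat[OF smult_carrier_mat[OF C]]] BC
      by (rule eq_matI; insert C CC; simp add: dims algebra_simps del: index_mult_mat)
  qed
  have sqC: "(1\<^sub>m n + q \<cdot>\<^sub>m (2 \<cdot>\<^sub>m C + q \<cdot>\<^sub>m (C * C))) * C
      = C + q \<cdot>\<^sub>m (2 \<cdot>\<^sub>m (C * C) + q \<cdot>\<^sub>m (C * C * C))"
  proof -
    have "(2 \<cdot>\<^sub>m C + q \<cdot>\<^sub>m (C * C)) * C = 2 \<cdot>\<^sub>m (C * C) + q \<cdot>\<^sub>m (C * C * C)"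
      using C CC by (subst add_mult_distrib_mat[of _ n n _ _ n])
        (auto simp: mult_smult_assoc_mat[OF C C] mult_smult_assoc_mat[OF CC C])
    moreover have "2 \<cdot>\<^sub>m C + q \<cdot>\<^sub>m (C * C) \<in> carrier_mat n n"
      using C CC by simp
    ultimately show ?thesis
      using C CC by (subst add_mult_distrib_mat[of _ n n _ _ n])
        (simp_all only: mult_smult_assoc_mat left_mult_one_mat smult_carrier_mat one_carrier_mat)
  qed
  have "?B ^\<^sub>m 3 = ?B * ?B * ?B"
    using C by (simp add: numeral_3_eq_3)
  also have "\<dots> = 1\<^sub>m n + q \<cdot>\<^sub>m (2 \<cdot>\<^sub>m C + q \<cdot>\<^sub>m (C * C))
      + q \<cdot>\<^sub>m (C + q \<cdot>\<^sub>m (2 \<cdot>\<^sub>m (C * C) + q \<cdot>\<^sub>m (C * C * C)))"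
    unfolding sq using C CC by (subst step) (auto simp only: sqC add_carrier_mat smult_carrier_mat)
  also have "\<dots> = 1\<^sub>m n + q \<cdot>\<^sub>m (3 \<cdot>\<^sub>m C + (3 * q) \<cdot>\<^sub>m (C * C) + (q * q) \<cdot>\<^sub>m (C * C * C))"
    by (rule lin[OF C CC CCC])
  finally show ?thesis .
qed

section \<open>Divisibility by 3 of the deviation from the identity\<close>

lemma one_plus_smult_eq_one_mat:
  fixes X :: "int mat"
  assumes X: "X \<in> carrier_mat n n" and q: "q \<noteq> 0"
    and eq: "1\<^sub>m n + q \<cdot>\<^sub>m X = 1\<^sub>m n" and ij: "i < n" "j < n"
  shows "X $$ (i, j) = 0"
proof -
  have "(1\<^sub>m n + q \<cdot>\<^sub>m X) $$ (i, j) = (1\<^sub>m n :: int mat) $$ (i, j)" using eq by simp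
  thus ?thesis using X q ij by simp
qed

lemma eq_smult_mat_if_dvd:
  fixes C :: "int mat"
  assumes C: "C \<in> carrier_mat n n" and "\<And>i j. i < n \<Longrightarrow> j < n \<Longrightarrow> q dvd C $$ (i, j)"
  obtains D where "D \<in> carrier_mat n n" "C = q \<cdot>\<^sub>m D"
proof
  let ?D = "mat n n (\<lambda>ij. C $$ ij div q)"
  show "?D \<in> carrier_mat n n" by simp
  show "C = q \<cdot>\<^sub>m ?D" using assms by (intro eq_matI) auto
qed

text \<open>Cancelling \<open>3 ^ k\<close> in the expansion leaves a relation with linear term
  \<open>m C\<close>. If 3 does not divide \<open>m\<close>, the rest is a multiple of 3 and
  primality removes \<open>m\<close>. If \<open>m = 3\<close>, the rest remains a multiple of 3
  after division by 3.\<close>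

lemma dvd_three_if_pow_mat_eq_one:
  fixes C :: "int mat"
  assumes C: "C \<in> carrier_mat n n" and k: "k \<ge> 1" and m: "m = 3 \<or> \<not> 3 dvd m"
    and pow: "(1\<^sub>m n + 3 ^ k \<cdot>\<^sub>m C) ^\<^sub>m m = 1\<^sub>m n"
    and ij: "i < n" "j < n"
  shows "3 dvd C $$ (i, j)"
proof -
  let ?q = "3 ^ k :: int"
  obtain r :: int where r: "?q = 3 * r"
    using k by (cases k) auto
  from m show ?thesis
  proof
    assume "m = 3"
    let ?Y = "3 \<cdot>\<^sub>m C + (3 * ?q) \<cdot>\<^sub>m (C * C) + (?q * ?q) \<cdot>\<^sub>m (C * C * C)"
    have CC: "C * C \<in> carrier_mat n n" and CCC: "C * C * C \<in> carrier_mat n n"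
      using C by auto
    have "?Y $$ (i, j) = 0"
      using C pow one_plus_smult_cube_mat[OF C, of ?q] \<open>m = 3\<close>
      by (intro one_plus_smult_eq_one_mat[of _ n ?q]) (auto simp: ij)
    hence "3 * C $$ (i, j) + 3 * ?q * (C * C) $$ (i, j) + ?q * ?q * (C * C * C) $$ (i, j) = 0"
      using ij by (simp add: carrier_matD[OF C] carrier_matD[OF CC] carrier_matD[OF CCC]
          del: index_mult_mat)
    \<comment> \<open>With \<open>?q = 3 * r\<close> the higher coefficients are \<open>9 r\<close>
      and \<open>9 r^2\<close>, so a factor 3 survives the division. The prime 2 would fail here: -1
      is congruent to 1 modulo 2 and squares to 1.\<close>
    hence "C $$ (i, j) = 3 * (- r * (C * C) $$ (i, j) - r * r * (C * C * C) $$ (i, j))"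
      unfolding r by (simp add: algebra_simps)
    thus ?thesis by (rule dvdI)
  next
    assume m: "\<not> 3 dvd m"
    obtain E where E: "E \<in> carrier_mat n n"
      and eq: "(1\<^sub>m n + ?q \<cdot>\<^sub>m C) ^\<^sub>m m = 1\<^sub>m n + ?q \<cdot>\<^sub>m (int m \<cdot>\<^sub>m C + ?q \<cdot>\<^sub>m E)"
      using one_plus_smult_pow_mat[OF C] by blast
    have "(int m \<cdot>\<^sub>m C + ?q \<cdot>\<^sub>m E) $$ (i, j) = 0"
      using C E pow eq by (intro one_plus_smult_eq_one_mat[of _ n ?q]) (auto simp: ij)
    hence "int m * C $$ (i, j) = 3 * (- r * E $$ (i, j))"
      using C E ij by (simp add: r)
    hence "3 dvd int m * C $$ (i, j)" by (rule dvdI)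
    moreover have "\<not> 3 dvd int m"
      using m by presburger
    ultimately show ?thesis
      using prime_dvd_mult_iff[of "3 :: int"] by simp
  qed
qed

section \<open>Descent on powers of 3\<close>

lemma int_eq_0_if_all_powers_dvd:
  fixes x :: int
  assumes "\<And>k. 3 ^ k dvd x"
  shows "x = 0"
proof (rule ccontr)
  assume "x \<noteq> 0"
  \<comment> \<open>The exponent \<bar>x\<bar> is chosen because its power of 3 exceeds
    \<bar>x\<bar>.\<close>
  hence "\<bar>3 ^ nat \<bar>x\<bar>\<bar> \<le> \<bar>x\<bar>"
    using assms dvd_imp_le_int by blast
  moreover have "nat \<bar>x\<bar> < 3 ^ nat \<bar>x\<bar>"
    by (rule less_exp[THEN less_le_trans]) (simp add: power_mono)
  hence "\<bar>x\<bar> < 3 ^ nat \<bar>x\<bar>"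
    by (simp add: nat_less_iff)
  ultimately show False by simp
qed

text \<open>Each factor 3 extracted from \<open>3 C\<close> leaves a matrix of the same kind with a
  higher power of 3 in front, so the extraction never stops and the entries vanish.\<close>

lemma one_plus_smult_three_eq_one_step:
  fixes C :: "int mat"
  assumes C: "C \<in> carrier_mat n n" and m: "m = 3 \<or> \<not> 3 dvd m"
    and pow: "(1\<^sub>m n + 3 \<cdot>\<^sub>m C) ^\<^sub>m m = 1\<^sub>m n"
  shows "1\<^sub>m n + 3 \<cdot>\<^sub>m C = 1\<^sub>m n"
proof -
  \<comment> \<open>The exponent \<open>Suc k\<close> stays at least 1, as the divisibility lemma
    requires.\<close>
  have deep: "\<exists>D \<in> carrier_mat n n. 3 \<cdot>\<^sub>m C = 3 ^ Suc k \<cdot>\<^sub>m D" for k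
  proof (induction k)
    case 0
    show ?case using C by (auto intro!: bexI[of _ C])
  next
    case (Suc k)
    then obtain D where D: "D \<in> carrier_mat n n" and CD: "3 \<cdot>\<^sub>m C = 3 ^ Suc k \<cdot>\<^sub>m D" by blast
    have "(1\<^sub>m n + 3 ^ Suc k \<cdot>\<^sub>m D) ^\<^sub>m m = 1\<^sub>m n" using pow CD by simp
    hence "3 dvd D $$ (i, j)" if "i < n" "j < n" for i j
      using dvd_three_if_pow_mat_eq_one[OF D _ m _ that, of "Suc k"] by simp
    then obtain E where E: "E \<in> carrier_mat n n" "D = 3 \<cdot>\<^sub>m E"
      using eq_smult_mat_if_dvd[OF D] by metis
    have "3 \<cdot>\<^sub>m C = 3 ^ Suc (Suc k) \<cdot>\<^sub>m E"
      unfolding CD E(2) using E(1) by (intro eq_matI) auto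
    thus ?case using E(1) by blast
  qed
  have "(3 \<cdot>\<^sub>m C) $$ (i, j) = 0" if ij: "i < n" "j < n" for i j
  proof (rule int_eq_0_if_all_powers_dvd)
    fix k
    obtain D where D: "D \<in> carrier_mat n n" and CD: "3 \<cdot>\<^sub>m C = 3 ^ Suc k \<cdot>\<^sub>m D"
      using deep by blast
    show "3 ^ k dvd (3 \<cdot>\<^sub>m C) $$ (i, j)"
      unfolding CD using D ij by simp
  qed
  thus ?thesis using C by (intro eq_matI) auto
qed

text \<open>If 3 divides \<open>m\<close>, the cube is again congruent to 1 modulo 3 and its power
  \<open>m div 3\<close> is 1; by induction the cube is 1, which leaves exponent 3. The induction
  varies \<open>C\<close> because the cube has a different deviation.\<close>

lemma finite_order_congruent_one_mat:
  fixes C :: "int mat"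
  assumes "C \<in> carrier_mat n n" and "0 < m" and "(1\<^sub>m n + 3 \<cdot>\<^sub>m C) ^\<^sub>m m = 1\<^sub>m n"
  shows "1\<^sub>m n + 3 \<cdot>\<^sub>m C = 1\<^sub>m n"
  using assms
proof (induction m arbitrary: C rule: less_induct)
  case (less m)
  note C = less.prems(1)
  show ?case
  proof (cases "3 dvd m")
    case False
    thus ?thesis using one_plus_smult_three_eq_one_step less.prems by blast
  next
    case True
    then obtain l where l: "m = 3 * l" by blast
    let ?B = "1\<^sub>m n + 3 \<cdot>\<^sub>m C"
    \<comment> \<open>The deviation of the cube, read off from the cubic expansion at
      \<open>q = 3\<close>.\<close>
    let ?D = "3 \<cdot>\<^sub>m C + (3 * 3) \<cdot>\<^sub>m (C * C) + (3 * 3) \<cdot>\<^sub>m (C * C * C)"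
    have D: "?D \<in> carrier_mat n n" using C by auto
    have cube: "?B ^\<^sub>m 3 = 1\<^sub>m n + 3 \<cdot>\<^sub>m ?D"
      by (rule one_plus_smult_cube_mat[OF C])
    have "(?B ^\<^sub>m 3) ^\<^sub>m l = 1\<^sub>m n"
      using less.prems(3) C unfolding l by (subst pow_mat_mult[symmetric, of _ n]) auto
    hence "?B ^\<^sub>m 3 = 1\<^sub>m n"
      unfolding cube using less.IH[OF _ D, of l] less.prems(2) l by simp
    thus ?thesis using one_plus_smult_three_eq_one_step[OF C, of 3] by simp
  qed
qed

section \<open>Counting residues modulo 3\<close>

lemma finite_mat_entries:
  assumes "finite S"
  shows "finite {M \<in> carrier_mat n n. \<forall>i<n. \<forall>j<n. M $$ (i, j) \<in> S}"
proof (rule finite_subset)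
  \<comment> \<open>Extensionality keeps this function set finite; \<open>mat n n\<close> ignores
    values outside the index square.\<close>
  let ?F = "({..<n} \<times> {..<n}) \<rightarrow>\<^sub>E S"
  show "finite (mat n n ` ?F)"
    using assms by (intro finite_imageI finite_PiE) auto
  show "{M \<in> carrier_mat n n. \<forall>i<n. \<forall>j<n. M $$ (i, j) \<in> S} \<subseteq> mat n n ` ?F"
  proof
    fix M assume M: "M \<in> {M \<in> carrier_mat n n. \<forall>i<n. \<forall>j<n. M $$ (i, j) \<in> S}"
    let ?f = "restrict (\<lambda>ij. M $$ ij) ({..<n} \<times> {..<n})"
    have "M = mat n n ?f" using M by (intro eq_matI) auto
    moreover have "?f \<in> ?F" using M by auto
    ultimately show "M \<in> mat n n ` ?F" by blast
  qed
qed

text \<open>If the powers for \<open>i < j\<close> agree modulo 3, then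
  \<open>A ^\<^sub>m (j - i)\<close> is congruent to 1 modulo 3 and has finite order, hence is 1,
  against the minimality of \<open>m\<close>.\<close>

lemma inj_on_pow_mat_mod_three:
  fixes A :: "int mat"
  assumes A: "A \<in> carrier_mat n n" and m: "A ^\<^sub>m m = 1\<^sub>m n"
    and least: "\<And>d. 0 < d \<Longrightarrow> d < m \<Longrightarrow> A ^\<^sub>m d \<noteq> 1\<^sub>m n"
  shows "inj_on (\<lambda>i. map_mat (\<lambda>x. x mod 3) (A ^\<^sub>m i)) {..<m}"
proof (rule linorder_inj_onI)
  fix i j assume "i < j" and "i \<in> {..<m}" and "j \<in> {..<m}"
  hence ij: "i < m" "j < m" by simp_all
  note P = pow_carrier_mat[OF A]
  \<comment> \<open>Since \<open>A ^\<^sub>m m\<close> is the identity, \<open>Y\<close> is the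
    inverse of \<open>A ^\<^sub>m i\<close>.\<close>
  define Y where "Y = A ^\<^sub>m (m - i)"
  have Y: "Y \<in> carrier_mat n n" by (simp add: Y_def P)
  show "map_mat (\<lambda>x. x mod 3) (A ^\<^sub>m i) \<noteq> map_mat (\<lambda>x. x mod 3) (A ^\<^sub>m j)"
  proof
    assume eq: "map_mat (\<lambda>x. x mod 3) (A ^\<^sub>m i) = map_mat (\<lambda>x. x mod 3) (A ^\<^sub>m j)"
    have "3 dvd (A ^\<^sub>m j - A ^\<^sub>m i) $$ (a, b)" if "a < n" "b < n" for a b
    proof -
      have "map_mat (\<lambda>x. x mod 3) (A ^\<^sub>m j) $$ (a, b) = map_mat (\<lambda>x. x mod 3) (A ^\<^sub>m i) $$ (a, b)"
        using eq by simp
      hence "(A ^\<^sub>m j) $$ (a, b) mod 3 = (A ^\<^sub>m i) $$ (a, b) mod 3"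
        using that P A by simp
      thus ?thesis using that A P by (simp add: mod_eq_dvd_iff)
    qed
    then obtain D where D: "D \<in> carrier_mat n n" and diff: "A ^\<^sub>m j - A ^\<^sub>m i = 3 \<cdot>\<^sub>m D"
      using eq_smult_mat_if_dvd[OF minus_carrier_mat[OF P]] by metis
    have Aj: "A ^\<^sub>m j = A ^\<^sub>m i + 3 \<cdot>\<^sub>m D"
      unfolding diff[symmetric] using A by (intro eq_matI) auto
    have "A ^\<^sub>m (j - i) = A ^\<^sub>m m * A ^\<^sub>m (j - i)"
      by (simp add: m left_mult_one_mat[OF P])
    also have "\<dots> = Y * A ^\<^sub>m j"
      unfolding Y_def pow_mat_add[OF A, symmetric] using \<open>i < j\<close> ij by simp
    also have "\<dots> = Y * A ^\<^sub>m i + 3 \<cdot>\<^sub>m (Y * D)"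
      unfolding Aj using D P Y
      by (subst mult_add_distrib_mat[of _ n n _ n]) (auto simp: mult_smult_distrib)
    also have "Y * A ^\<^sub>m i = 1\<^sub>m n"
      unfolding Y_def pow_mat_add[OF A, symmetric] using m ij by simp
    finally have d: "A ^\<^sub>m (j - i) = 1\<^sub>m n + 3 \<cdot>\<^sub>m (Y * D)" .
    have "(A ^\<^sub>m (j - i)) ^\<^sub>m m = (A ^\<^sub>m m) ^\<^sub>m (j - i)"
      using A by (simp add: pow_mat_mult[OF A, symmetric] mult.commute)
    also have "\<dots> = 1\<^sub>m n" unfolding m by (rule one_mat_pow)
    finally have "A ^\<^sub>m (j - i) = 1\<^sub>m n"
      unfolding d using Y D ij by (intro finite_order_congruent_one_mat[of _ n m]) auto
    thus False using least[of "j - i"] \<open>i < j\<close> ij by simp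
  qed
qed auto

text \<open>Carries facts about group orders over to matrix powers; membership in the carrier fixes
  the dimension, so that the zeroth powers agree.\<close>

lemma nat_pow_Sp: "A [^]\<^bsub>Sp g\<^esub> (k :: nat) = A ^\<^sub>m k" if "A \<in> carrier (Sp g)"
  using that by (induction k) (auto simp: Sp_def nat_pow_def)

theorem theorem3p1:
  fixes g :: nat
  assumes "g \<ge> 1"
  shows "bounded (real ` orders g)"
proof -
  let ?n = "2 * g"
  \<comment> \<open>Matrices over Z/3Z, encoded by the representatives 0, 1, 2 that
    \<open>mod\<close> returns.\<close>
  let ?R = "{M \<in> carrier_mat ?n ?n. \<forall>i<?n. \<forall>j<?n. M $$ (i, j) \<in> {0..<3 :: int}}"
  interpret group "Sp g" by (rule group_Sp)
  have "m \<le> card ?R" if mem: "m \<in> orders g" for m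
  proof -
    obtain A where m: "0 < m" and A: "A \<in> carrier (Sp g)" and ord: "ord A = m"
      using mem by (auto simp: orders_def)
    have An: "A \<in> carrier_mat ?n ?n" using A by (simp add: Sp_def)
    \<comment> \<open>This supplies both premises of the injectivity lemma: the power
      \<open>m\<close> is 1, and no smaller positive power is.\<close>
    have one: "A ^\<^sub>m d = 1\<^sub>m ?n \<longleftrightarrow> m dvd d" for d
      using pow_eq_id[OF A, of d] unfolding nat_pow_Sp[OF A] ord by (simp add: Sp_def)
    have "inj_on (\<lambda>i. map_mat (\<lambda>x. x mod 3) (A ^\<^sub>m i)) {..<m}"
      by (rule inj_on_pow_mat_mod_three[OF An]) (auto simp: one dest: dvd_imp_le)
    moreover have "(\<lambda>i. map_mat (\<lambda>x. x mod 3) (A ^\<^sub>m i)) ` {..<m} \<subseteq> ?R"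
      using An by auto
    ultimately have "card {..<m} \<le> card ?R"
      by (rule card_inj_on_le) (rule finite_mat_entries, simp)
    thus ?thesis by simp
  qed
  \<comment> \<open>The bound \<open>card ?R\<close> depends on \<open>g\<close> alone.\<close>
  hence "\<forall>x \<in> real ` orders g. norm x \<le> real (card ?R)" by auto
  thus ?thesis unfolding bounded_iff by blast
qed

end
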